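(* Let $\Omega\subset\mathbb{R}^n$ be open. Fix $\delta>0$, $0<\tau<1$, a ball $B\subset B_1$ and a real-valued $u\in L^1_{loc}(\Omega)$. Then the set $$E_{\delta,\tau,B}:=\{x\in\Omega:\ \exists\, r_0>0\text{ such that } u^{x,r}\in \mathcal{F}_{\delta,\tau, B}\text{ for every } 0<r\leq r_0\}$$ can be covered by countably many $(n-1)$-dimensional Lipschitz graphs.
   Context: $B_1$ is the Euclidean unit ball of $\mathbb{R}^n$ centered at the origin; balls are Euclidean with positive radius. For $x\in\Omega$ and $r>0$ sufficiently small (depending on $x$), $u^{x,r}\in L^1(B_1)$ is defined by $u^{x,r}(y):=u(x+ry)$ (the condition $u^{x,r}\in\mathcal{F}_{\delta,\tau,B}$ includes that $u^{x,r}$ is well-defined and in $L^1(B_1)$). For an integrable function $w$ on a Borel set $A$ with Lebesgue measure $0<|A|<\infty$, the oscillation of $w$ on $A$ is $$\mathrm{osc}(w,A):=\inf_{c\in\mathbb{R}}\frac1{|A|}\int_A|w(y)-c|\,dy.$$ For $\delta>0$, $0<\tau<1$ and a ball $B\subset B_1$, $$\mathcal{F}_{\delta,\tau,B}:=\{w\in L^1(B_1):\ \mathrm{osc}(w,B_1)\geq\delta,\ \mathrm{osc}(w,B)\leq\tau\delta\}.$$ An $(n-1)$-dimensional Lipschitz graph in $\mathbb{R}^n$ is a set that, up to a rotation of $\mathbb{R}^n$, is the graph $\{(t,f(t)):t\in\mathbb{R}^{n-1}\}$ of a Lipschitz function $f:\mathbb{R}^{n-1}\to\mathbb{R}$. The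 covering is of the whole set, with no exceptional null set. *)

theory Defs
  imports "HOL-Analysis.Analysis"
begin

definition L1 :: "'a::euclidean_space set \<Rightarrow> ('a \<Rightarrow> real) set" where
  "L1 A = {w. w absolutely_integrable_on A}"

text \<open>Only the values of \<open>u\<close> on \<open>\<Omega>\<close> matter.\<close>

definition L1_loc :: "'a::euclidean_space set \<Rightarrow> ('a \<Rightarrow> real) set" where
  "L1_loc \<Omega> = {u. \<forall>K. compact K \<and> K \<subseteq> \<Omega> \<longrightarrow> u \<in> L1 K}"

text \<open>Meaningful for \<open>w \<in> L1 A\<close> and \<open>0 < measure lebesgue A < \<infinity>\<close>.\<close>

definition osc :: "('a::euclidean_space \<Rightarrow> real) \<Rightarrow> 'a set \<Rightarrow> real" where
  "osc w A = (INF c. 1 / measure lebesgue A * (LINT y:A|lebesgue. \<bar>w y - c\<bar>))"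

definition osc_class :: "real \<Rightarrow> real \<Rightarrow> 'a::euclidean_space set \<Rightarrow> ('a \<Rightarrow> real) set" where
  "osc_class \<delta> \<tau> B = {w \<in> L1 (ball 0 1). osc w (ball 0 1) \<ge> \<delta> \<and> osc w B \<le> \<tau> * \<delta>}"

definition blowup :: "('a::euclidean_space \<Rightarrow> real) \<Rightarrow> 'a \<Rightarrow> real \<Rightarrow> 'a \<Rightarrow> real" where
  "blowup u x r = (\<lambda>y. u (x + r *\<^sub>R y))"

text \<open>
  As \<open>u\<close> is a total function, the requirement that the rescaled function is well defined on the
  unit ball, i.e. depends only on values of \<open>u\<close> in \<open>\<Omega>\<close>, is stated separately.
\<close>

definition E_set ::
  "'a::euclidean_space set \<Rightarrow> ('a \<Rightarrow> real) \<Rightarrow> real \<Rightarrow> real \<Rightarrow> 'a set \<Rightarrow> 'a set" where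
  "E_set \<Omega> u \<delta> \<tau> B =
     {x \<in> \<Omega>. \<exists>r0>0. \<forall>r. 0 < r \<and> r \<le> r0 \<longrightarrow>
        (\<forall>y\<in>ball 0 1. x + r *\<^sub>R y \<in> \<Omega>) \<and> blowup u x r \<in> osc_class \<delta> \<tau> B}"

text \<open>
  The space of dimension \<open>n - 1\<close> is realised as the coordinate hyperplane \<open>{t. t $ k = 0}\<close>, so that
  \<open>(t, f t)\<close> becomes \<open>t + f t *\<^sub>R axis k 1\<close>; the index type has no distinguished last coordinate,
  hence the choice of \<open>k\<close>, which up to a rotation is immaterial. For \<open>n = 1\<close> the hyperplane is
  \<open>{0}\<close> and the graphs are the singletons.
\<close>

definition lipschitz_graph :: "(real ^ 'n) set \<Rightarrow> bool" where
  "lipschitz_graph S \<longleftrightarrow>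
     (\<exists>Q k f L. rotation_matrix Q \<and> L-lipschitz_on {t. t $ k = 0} f \<and>
        S = (\<lambda>z. Q *v z) ` {t + f t *\<^sub>R axis k 1 | t. t $ k = 0})"

end

theory Submission
  imports Defs
begin

text \<open>
  Let \<open>E\<^sub>k\<close> be the set of points at which the defining conditions hold at all scales \<open>r \<le> 1/k\<close>.
  If \<open>x, y \<in> E\<^sub>k\<close> and \<open>y\<close> is close to \<open>x + r b\<close>, more precisely \<open>\<bar>y - x - r b\<bar> \<le> (1 - \<theta>) s r\<close>
  with \<open>\<theta> < 1 < \<theta>\<^sup>n / \<tau>\<close>, then the ball of radius \<open>\<theta> s r\<close> around \<open>y\<close> lies in \<open>x + r B\<close>. The
  oscillation of \<open>u\<close> is then at least \<open>\<delta>\<close> on the former and at most \<open>\<tau> \<delta>\<close> on the latter, although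
  shrinking the ball increases the oscillation at most by the factor \<open>\<theta>\<^bsup>-n\<^esup> < 1 / \<tau>\<close>. So, locally,
  \<open>E\<^sub>k\<close> avoids a cone around the direction \<open>b\<close> at each of its points (and \<open>E\<^sub>k\<close> is empty if
  \<open>b = 0\<close>), hence it lies on countably many Lipschitz graphs over \<open>b\<^sup>\<bottom>\<close>.
\<close>

section \<open>Oscillation under rescaling and passage to a smaller ball\<close>

lemma lebesgue_integral_affine:
  fixes f :: "'a::euclidean_space \<Rightarrow> real"
  assumes f: "integrable lebesgue f" and c: "c \<noteq> 0"
  shows "(LINT x|lebesgue. f x) = \<bar>c\<bar> ^ DIM('a) * (LINT x|lebesgue. f (t + c *\<^sub>R x))"
proof -
  define T :: "'a \<Rightarrow> 'a" where "T = (\<lambda>x. t + c *\<^sub>R x)"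
  \<comment> \<open>The coordinatewise affine map with the same factor \<open>c\<close> in every
    coordinate is the dilation \<open>T\<close>.\<close>
  have T: "(\<lambda>x. t + (\<Sum>j\<in>Basis. (c * (x \<bullet> j)) *\<^sub>R j)) = T"
    unfolding T_def scaleR_scaleR[symmetric] scaleR_sum_right[symmetric]
    by (simp add: euclidean_representation)
  have meas: "T \<in> lebesgue \<rightarrow>\<^sub>M lebesgue"
    using lebesgue_affine_measurable[of "\<lambda>_. c" t] c by (simp add: T)
  have leb: "lebesgue = density (distr lebesgue lebesgue T) (\<lambda>_. ennreal (\<bar>c\<bar> ^ DIM('a)))"
    using lebesgue_affine_euclidean[of "\<lambda>_. c" t] c by (simp add: T)
  have fm: "f \<in> borel_measurable lebesgue" using f by auto
  have "(LINT x|lebesgue. f x)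
      = (LINT x|density (distr lebesgue lebesgue T) (\<lambda>_. ennreal (\<bar>c\<bar> ^ DIM('a))). f x)"
    using leb by simp
  also have "\<dots> = (LINT x|distr lebesgue lebesgue T. \<bar>c\<bar> ^ DIM('a) *\<^sub>R f x)"
    by (rule integral_density) (use fm in auto)
  also have "\<dots> = (LINT x|lebesgue. \<bar>c\<bar> ^ DIM('a) *\<^sub>R f (T x))"
    by (rule integral_distr) (use fm meas in auto)
  finally show ?thesis by (simp add: T_def)
qed

lemma set_lebesgue_integral_ball_rescale:
  fixes f :: "'a::euclidean_space \<Rightarrow> real"
  assumes f: "set_integrable lebesgue (ball a r) f" and r: "0 < r"
  shows "(LINT y:ball a r|lebesgue. f y)
       = r ^ DIM('a) * (LINT z:ball 0 1|lebesgue. f (a + r *\<^sub>R z))"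
proof -
  have ind: "indicator (ball a r) (a + r *\<^sub>R z) = (indicator (ball 0 1) z :: real)" for z
    using r by (auto simp: indicator_def dist_norm)
  have "(LINT y|lebesgue. indicator (ball a r) y *\<^sub>R f y)
      = \<bar>r\<bar> ^ DIM('a) *
        (LINT z|lebesgue. indicator (ball a r) (a + r *\<^sub>R z) *\<^sub>R f (a + r *\<^sub>R z))"
    using f r unfolding set_integrable_def by (intro lebesgue_integral_affine) auto
  then show ?thesis
    using r by (simp add: set_lebesgue_integral_def ind)
qed

text \<open>For each constant \<open>c\<close>, the integral of \<open>\<bar>w - c\<bar>\<close> can
  only grow from the small ball to the large one, so the mean over the small ball is at most the
  volume ratio times the mean over the large ball. Rescaling turns the former into a mean over the
  unit ball.\<close>

lemma osc_rescale_le: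
  fixes w :: "'a::euclidean_space \<Rightarrow> real"
  assumes w: "w \<in> L1 (ball b s)" and r: "0 < r" and sub: "ball a r \<subseteq> ball b s"
  shows "osc (\<lambda>z. w (a + r *\<^sub>R z)) (ball 0 1) \<le> (s / r) ^ DIM('a) * osc w (ball b s)"
proof -
  define V where "V = measure lebesgue (ball (0::'a) 1)"
  have V: "V > 0" by (simp add: V_def content_ball_pos)
  have s: "0 < s"
    using sub r by (metis ball_eq_empty linorder_not_le subset_empty)
  have mB: "measure lebesgue (ball b s) = s ^ DIM('a) * V"
    using s content_ball_conv_unit_ball[of s b] by (simp add: V_def)
  have main: "osc (\<lambda>z. w (a + r *\<^sub>R z)) (ball 0 1)
      \<le> (s / r) ^ DIM('a) * (1 / measure lebesgue (ball b s) * (LINT y:ball b s|lebesgue. \<bar>w y - c\<bar>))"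
    for c
  proof -
    have "(\<lambda>y. w y - c) absolutely_integrable_on ball b s"
      using w by (intro set_integral_diff absolutely_integrable_on_const) (auto simp: L1_def)
    then have int: "set_integrable lebesgue (ball b s) (\<lambda>y. \<bar>w y - c\<bar>)"
      using set_integrable_abs by blast
    then have int': "set_integrable lebesgue (ball a r) (\<lambda>y. \<bar>w y - c\<bar>)"
      by (rule set_integrable_subset) (use sub in auto)
    have "osc (\<lambda>z. w (a + r *\<^sub>R z)) (ball 0 1)
        \<le> 1 / V * (LINT z:ball 0 1|lebesgue. \<bar>w (a + r *\<^sub>R z) - c\<bar>)"
      unfolding osc_def V_def
      by (rule cINF_lower)
         (auto intro!: bdd_belowI[of _ 0] mult_nonneg_nonneg divide_nonneg_nonneg
            simp: set_lebesgue_integral_def)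
    also have "\<dots> = 1 / (r ^ DIM('a) * V) * (LINT y:ball a r|lebesgue. \<bar>w y - c\<bar>)"
      using r by (simp add: set_lebesgue_integral_ball_rescale[OF int' r])
    also have "\<dots> \<le> 1 / (r ^ DIM('a) * V) * (LINT y:ball b s|lebesgue. \<bar>w y - c\<bar>)"
    proof (rule mult_left_mono)
      show "(LINT y:ball a r|lebesgue. \<bar>w y - c\<bar>) \<le> (LINT y:ball b s|lebesgue. \<bar>w y - c\<bar>)"
        unfolding set_lebesgue_integral_def
        by (rule integral_mono)
           (use int int' sub in \<open>auto simp: set_integrable_def indicator_def\<close>)
    qed (use r V in auto)
    also have "\<dots> = (s / r) ^ DIM('a) *
        (1 / measure lebesgue (ball b s) * (LINT y:ball b s|lebesgue. \<bar>w y - c\<bar>))"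
      using s r V by (simp add: mB power_divide)
    finally show ?thesis .
  qed
  \<comment> \<open>With the factor moved to the left, that side is a lower bound for every mean in
    the infimum over \<open>c\<close>.\<close>
  have "osc (\<lambda>z. w (a + r *\<^sub>R z)) (ball 0 1) / (s / r) ^ DIM('a) \<le> osc w (ball b s)"
    unfolding osc_def[of w]
    by (rule cINF_greatest) (use main s r in \<open>auto simp: pos_divide_le_eq mult.commute\<close>)
  then show ?thesis
    using s r by (simp add: pos_divide_le_eq mult.commute)
qed

lemma osc_class_avoids_cone:
  fixes u :: "'a::euclidean_space \<Rightarrow> real"
  assumes \<delta>: "0 < \<delta>" and s: "0 < s" and sub: "ball b s \<subseteq> ball 0 1"
    and \<theta>: "0 < \<theta>" "\<theta> < 1" "\<tau> < \<theta> ^ DIM('a)"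
    and x: "\<And>\<rho>. 0 < \<rho> \<Longrightarrow> \<rho> \<le> R \<Longrightarrow> blowup u x \<rho> \<in> osc_class \<delta> \<tau> (ball b s)"
    and y: "\<And>\<rho>. 0 < \<rho> \<Longrightarrow> \<rho> \<le> R \<Longrightarrow> blowup u y \<rho> \<in> osc_class \<delta> \<tau> (ball b s)"
    and r: "0 < r" "r \<le> R"
  shows "(1 - \<theta>) * s * r < norm (y - x - r *\<^sub>R b)"
proof (rule ccontr)
  assume "\<not> ?thesis"
  then have close: "norm (y - x - r *\<^sub>R b) \<le> (1 - \<theta>) * s * r" by simp
  \<comment> \<open>\<open>a\<close> is the position of \<open>y\<close> in the coordinates of the
    blow-up at \<open>x\<close> with scale \<open>r\<close>.\<close>
  define a where "a = (1 / r) *\<^sub>R (y - x)"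
  \<comment> \<open>This keeps the scale \<open>\<theta> * s * r\<close> below \<open>r\<close>, so
    that the assumption at \<open>y\<close> covers it.\<close>
  have s1: "s \<le> 1"
    using sub s by (auto simp: ball_subset_ball_iff) (metis add_increasing norm_ge_zero order_trans order.refl le_add_same_cancel2)
  have "\<theta> * s \<le> 1" using \<theta> s s1 by (simp add: mult_le_one)
  then have "\<theta> * s * r \<le> r" using r by simp
  then have \<rho>: "0 < \<theta> * s * r" "\<theta> * s * r \<le> R"
    using \<theta>(1) s r by (simp, linarith)
  have "a - b = (1 / r) *\<^sub>R (y - x - r *\<^sub>R b)"
    using r by (simp add: a_def scaleR_diff_right)
  then have "norm (a - b) \<le> (1 - \<theta>) * s"
    using close r by (simp add: pos_divide_le_eq)
  \<comment> \<open>The distance of the centres plus the smaller radius is at most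
    \<open>(1 - \<theta>) * s + \<theta> * s = s\<close>.\<close>
  then have sub': "ball a (\<theta> * s) \<subseteq> ball b s"
    by (simp add: ball_subset_ball_iff dist_norm algebra_simps)
  have wx: "blowup u x r \<in> osc_class \<delta> \<tau> (ball b s)" using x r by simp
  have wL: "blowup u x r \<in> L1 (ball b s)"
    using wx sub unfolding osc_class_def L1_def by (auto intro: set_integrable_subset)
  have eq: "blowup u y (\<theta> * s * r) = (\<lambda>z. blowup u x r (a + (\<theta> * s) *\<^sub>R z))"
    using r by (auto simp: blowup_def a_def scaleR_add_right mult_ac)
  have "\<delta> \<le> osc (blowup u y (\<theta> * s * r)) (ball 0 1)"
    using y[OF \<rho>] by (simp add: osc_class_def)
  also have "\<dots> \<le> (s / (\<theta> * s)) ^ DIM('a) * osc (blowup u x r) (ball b s)"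
    unfolding eq by (rule osc_rescale_le[OF wL _ sub']) (use \<theta> s in auto)
  also have "\<dots> \<le> (s / (\<theta> * s)) ^ DIM('a) * (\<tau> * \<delta>)"
    by (rule mult_left_mono) (use wx \<theta> s in \<open>auto simp: osc_class_def\<close>)
  also have "\<dots> = (\<tau> / \<theta> ^ DIM('a)) * \<delta>"
    using s by (simp add: power_divide)
  also have "\<dots> < 1 * \<delta>"
    by (rule mult_strict_right_mono) (use \<theta> \<delta> in \<open>auto simp: divide_less_eq\<close>)
  finally show False by simp
qed

section \<open>From cone conditions to Lipschitz graphs\<close>

text \<open>The McShane extension; the points \<open>p i\<close> at which values are prescribed need not be distinct.\<close>

lemma lipschitz_interpolation:
  fixes p :: "'i \<Rightarrow> 'a::metric_space" and h :: "'i \<Rightarrow> real"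
  assumes L: "0 \<le> L" and h: "\<And>i j. i \<in> A \<Longrightarrow> j \<in> A \<Longrightarrow> \<bar>h i - h j\<bar> \<le> L * dist (p i) (p j)"
  obtains f where "L-lipschitz_on UNIV f" and "\<And>i. i \<in> A \<Longrightarrow> f (p i) = h i"
proof (cases "A = {}")
  case True
  then show ?thesis using that[of "\<lambda>_. 0"] L by (simp add: lipschitz_on_def)
next
  case False
  then obtain i0 where i0: "i0 \<in> A" by auto
  define f where "f t = (INF i\<in>A. h i + L * dist (p i) t)" for t
  \<comment> \<open>The Lipschitz bound against the fixed index \<open>i0\<close> gives a lower
    bound independent of \<open>i\<close>.\<close>
  have bdd: "bdd_below ((\<lambda>i. h i + L * dist (p i) t) ` A)" for t
  proof (rule bdd_belowI2)
    fix i assume "i \<in> A"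
    moreover have "L * dist (p i) (p i0) \<le> L * (dist (p i) t + dist (p i0) t)"
      using L dist_triangle2 by (intro mult_left_mono) auto
    ultimately show "h i0 - L * dist (p i0) t \<le> h i + L * dist (p i) t"
      using h[OF i0 \<open>i \<in> A\<close>] by (simp add: dist_commute algebra_simps)
  qed
  have le: "f t \<le> f t' + L * dist t t'" for t t'
  proof -
    have "f t - L * dist t t' \<le> f t'"
      unfolding f_def[of t']
    proof (rule cINF_greatest[OF False])
      fix i assume i: "i \<in> A"
      have "f t \<le> h i + L * dist (p i) t"
        unfolding f_def by (rule cINF_lower[OF bdd i])
      moreover have "L * dist (p i) t \<le> L * (dist (p i) t' + dist t t')"
        using L dist_triangle2 by (intro mult_left_mono) auto
      ultimately show "f t - L * dist t t' \<le> h i + L * dist (p i) t'"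
        by (simp add: algebra_simps)
    qed
    then show ?thesis by simp
  qed
  show ?thesis
  proof
    show "L-lipschitz_on UNIV f"
    proof (rule lipschitz_onI[OF _ L])
      fix t t' show "dist (f t) (f t') \<le> L * dist t t'"
        using le[of t t'] le[of t' t] by (simp add: dist_real_def dist_commute)
    qed
    fix i assume i: "i \<in> A"
    have "f (p i) \<le> h i + L * dist (p i) (p i)"
      unfolding f_def by (rule cINF_lower[OF bdd i])
    moreover have "h i \<le> f (p i)"
      unfolding f_def
    proof (rule cINF_greatest[OF False])
      fix j assume "j \<in> A"
      then show "h i \<le> h j + L * dist (p j) (p i)"
        using h[OF i, of j] by (simp add: dist_commute)
    qed
    ultimately show "f (p i) = h i" by simp
  qed
qed

text \<open>In dimension one the only rotation is the identity, hence the sign.\<close>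

lemma rotation_matrix_axis_up_to_sign:
  fixes e :: "real ^ 'n"
  assumes e: "norm e = 1"
  obtains Q and k :: 'n where "rotation_matrix Q" and "Q *v axis k 1 = e \<or> Q *v axis k 1 = - e"
proof (cases "2 \<le> CARD('n)")
  case True
  then show ?thesis using rotation_matrix_exists_basis[OF True e] that by metis
next
  case False
  moreover have "0 < CARD('n)" by simp
  ultimately have "CARD('n) = 1" by linarith
  then obtain k :: 'n where k: "UNIV = {k}" by (auto simp: card_1_singleton_iff)
  have ek: "e = e $ k *\<^sub>R axis k 1"
    using k by (auto simp: vec_eq_iff axis_def)
  then have "\<bar>e $ k\<bar> = 1"
    using e by (metis mult.right_neutral norm_axis_1 norm_scaleR)
  then have "e $ k = 1 \<or> e $ k = - 1" by linarith
  then have "mat 1 *v axis k 1 = e \<or> mat 1 *v axis k 1 = - e"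
    using ek by (metis matrix_vector_mul_lid minus_minus scaleR_minus1_left scaleR_one)
  moreover have "rotation_matrix (mat 1 :: real ^ 'n ^ 'n)"
    by (simp add: rotation_matrix_def orthogonal_matrix_id)
  ultimately show ?thesis using that by blast
qed

text \<open>The cone condition says that the height along \<open>e\<close> is an
  \<open>L\<close>-Lipschitz function of the projection to the hyperplane orthogonal to
  \<open>e\<close>. The McShane extension defines it on the whole hyperplane, and a rotation brings
  the hyperplane to coordinate form.\<close>

lemma lipschitz_graph_of_cone_condition:
  fixes A :: "(real ^ 'n) set" and e :: "real ^ 'n"
  assumes e: "norm e = 1" and L: "0 \<le> L"
    and cone: "\<And>x y. x \<in> A \<Longrightarrow> y \<in> A \<Longrightarrow>
      \<bar>(y - x) \<bullet> e\<bar> \<le> L * norm (y - x - ((y - x) \<bullet> e) *\<^sub>R e)"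
  obtains S where "lipschitz_graph S" and "A \<subseteq> S"
proof -
  obtain Q and k :: 'n where Q: "rotation_matrix Q"
    and Qe: "Q *v axis k 1 = e \<or> Q *v axis k 1 = - e"
    using rotation_matrix_axis_up_to_sign[OF e] .
  \<comment> \<open>\<open>e'\<close> is \<open>e\<close> or \<open>- e\<close>; the cone condition
    is invariant under this change of sign.\<close>
  define e' where "e' = Q *v axis k 1"
  define h where "h x = x \<bullet> e'" for x
  \<comment> \<open>\<open>p x\<close> is the projection of \<open>x\<close> along
    \<open>e'\<close>, rotated back into the coordinate hyperplane.\<close>
  define p where "p x = transpose Q *v x - h x *\<^sub>R axis k 1" for x
  have Qm: "orthogonal_matrix Q" using Q by (simp add: rotation_matrix_def)
  then have QQ: "Q *v (transpose Q *v x) = x" for x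
    by (simp add: matrix_vector_mul_assoc orthogonal_matrix_def del: transpose_matrix_vector)
  have Qn: "norm (Q *v z) = norm z" for z
    using Qm orthogonal_transformation_matrix[of "(*v) Q"]
    by (simp add: orthogonal_transformation_norm)
  have hk: "(transpose Q *v x) $ k = h x" for x
    by (metis dot_lmul_matrix e'_def h_def inner_axis' inner_commute inner_real_def mult.commute
        mult.right_neutral transpose_matrix_vector)
  have Qp: "Q *v (p x) = x - h x *\<^sub>R e'" for x
    by (simp add: p_def matrix_vector_mult_diff_distrib QQ e'_def matrix_vector_mult_scaleR
        del: transpose_matrix_vector)
  have p0: "p x $ k = 0" for x
    by (simp add: p_def hk del: transpose_matrix_vector)
  have "\<bar>h x - h y\<bar> \<le> L * dist (p x) (p y)" if "x \<in> A" "y \<in> A" for x y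
  proof -
    have "dist (p x) (p y) = norm (Q *v (p x - p y))"
      by (simp add: Qn dist_norm)
    also have "Q *v (p x - p y) = x - y - ((x - y) \<bullet> e') *\<^sub>R e'"
      by (simp add: matrix_vector_mult_diff_distrib Qp h_def algebra_simps)
    also have "((x - y) \<bullet> e') *\<^sub>R e' = ((x - y) \<bullet> e) *\<^sub>R e"
      using Qe by (auto simp: e'_def)
    moreover have "\<bar>h x - h y\<bar> = \<bar>(x - y) \<bullet> e\<bar>"
      using Qe by (auto simp: h_def e'_def inner_diff_left)
    ultimately show ?thesis
      using cone[OF that(2,1)] by simp
  qed
  \<comment> \<open>The points of \<open>A\<close> themselves serve as indices of the prescribed
    values.\<close>
  then obtain f where f: "L-lipschitz_on UNIV f" and fp: "\<And>x. x \<in> A \<Longrightarrow> f (p x) = h x"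
    using lipschitz_interpolation[OF L] by metis
  define S where "S = (\<lambda>z. Q *v z) ` {t + f t *\<^sub>R axis k 1 | t. t $ k = 0}"
  show ?thesis
  proof
    show "lipschitz_graph S"
      unfolding lipschitz_graph_def S_def using Q lipschitz_on_subset[OF f] by blast
    show "A \<subseteq> S"
    proof
      fix x assume "x \<in> A"
      then have "x = Q *v (p x + f (p x) *\<^sub>R axis k 1)"
        by (simp add: fp matrix_vector_right_distrib Qp matrix_vector_mult_scaleR e'_def)
      then show "x \<in> S" unfolding S_def using p0 by blast
    qed
  qed
qed

text \<open>If \<open>y\<close> is higher than \<open>x\<close> along \<open>b\<close>, a suitable
  scale \<open>r\<close> turns \<open>avoid\<close> into a bound of the height difference by the
  orthogonal part. The diameter bound makes this scale admissible, and exchanging \<open>x\<close>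
  and \<open>y\<close> gives the absolute value.\<close>

lemma lipschitz_graph_of_small_scales:
  fixes A :: "(real ^ 'n) set" and b :: "real ^ 'n"
  assumes \<epsilon>: "0 < \<epsilon>" and b: "b \<noteq> 0"
    and avoid: "\<And>x y r. x \<in> A \<Longrightarrow> y \<in> A \<Longrightarrow> 0 < r \<Longrightarrow> r \<le> R \<Longrightarrow> \<epsilon> * r < norm (y - x - r *\<^sub>R b)"
    and diam: "\<And>x y. x \<in> A \<Longrightarrow> y \<in> A \<Longrightarrow> dist x y \<le> R * norm b"
  obtains S where "lipschitz_graph S" and "A \<subseteq> S"
proof -
  define e where "e = b /\<^sub>R norm b"
  have e: "norm e = 1" and be: "b = norm b *\<^sub>R e" using b by (auto simp: e_def)
  define P where "P v = v - (v \<bullet> e) *\<^sub>R e" for v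
  have one_sided: "(y - x) \<bullet> e \<le> norm b / \<epsilon> * norm (P (y - x))" if "x \<in> A" "y \<in> A" for x y
  proof (cases "0 < (y - x) \<bullet> e")
    case True
    \<comment> \<open>With this \<open>r\<close>, \<open>r *\<^sub>R b\<close> is the component of
      \<open>y - x\<close> along \<open>e\<close>, so what remains is
      \<open>P (y - x)\<close>.\<close>
    define r where "r = (y - x) \<bullet> e / norm b"
    have "(y - x) \<bullet> e \<le> norm (y - x)"
      using norm_cauchy_schwarz[of "y - x" e] e by simp
    also have "\<dots> \<le> R * norm b"
      using diam[OF that] by (simp add: dist_norm norm_minus_commute)
    finally have "r \<le> R" using b by (simp add: r_def pos_divide_le_eq)
    moreover have "0 < r" using True b by (simp add: r_def)
    ultimately have "\<epsilon> * r < norm (y - x - r *\<^sub>R b)" using avoid that by blast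
    also have "r *\<^sub>R b = ((y - x) \<bullet> e) *\<^sub>R e"
      by (subst be) (use b in \<open>simp add: r_def\<close>)
    finally show ?thesis using \<epsilon> b by (simp add: r_def P_def field_simps)
  next
    case False
    moreover have "0 \<le> norm b / \<epsilon> * norm (P (y - x))" using \<epsilon> by simp
    ultimately show ?thesis by linarith
  qed
  have "\<bar>(y - x) \<bullet> e\<bar> \<le> norm b / \<epsilon> * norm (y - x - ((y - x) \<bullet> e) *\<^sub>R e)"
    if "x \<in> A" "y \<in> A" for x y
  proof -
    have "P (x - y) = - P (y - x)" by (simp add: P_def algebra_simps)
    then have "(x - y) \<bullet> e \<le> norm b / \<epsilon> * norm (P (y - x))"
      using one_sided[OF that(2,1)] by simp
    then show ?thesis
      using one_sided[OF that] by (simp add: P_def abs_le_iff inner_diff_left)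
  qed
  then show ?thesis
    using lipschitz_graph_of_cone_condition[OF e, of "norm b / \<epsilon>" A] \<epsilon> that by auto
qed

section \<open>The countable covering\<close>

theorem proposition1p4:
  fixes \<Omega> :: "(real ^ 'n) set" and u :: "real ^ 'n \<Rightarrow> real"
    and \<delta> \<tau> s :: real and b :: "real ^ 'n" and B :: "(real ^ 'n) set"
  assumes "open \<Omega>"
    and "0 < \<delta>"
    and "0 < \<tau>" and "\<tau> < 1"
    and "0 < s" and "B = ball b s" and "B \<subseteq> ball 0 1"
    and "u \<in> L1_loc \<Omega>"
  shows "\<exists>\<G>. countable \<G> \<and> (\<forall>S\<in>\<G>. lipschitz_graph S) \<and> E_set \<Omega> u \<delta> \<tau> B \<subseteq> \<Union>\<G>"
proof -
  \<comment> \<open>The power of \<open>\<theta>\<close> to the dimension is the midpoint of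
    \<open>\<tau>\<close> and 1.\<close>
  define \<theta> where "\<theta> = root CARD('n) ((\<tau> + 1) / 2)"
  have \<theta>: "0 < \<theta>" "\<theta> < 1" "\<tau> < \<theta> ^ DIM(real ^ 'n)"
    using assms(3,4) by (simp_all add: \<theta>_def)
  define E where "E k = {x. \<forall>\<rho>. 0 < \<rho> \<and> \<rho> \<le> inverse (real (Suc k)) \<longrightarrow>
      blowup u x \<rho> \<in> osc_class \<delta> \<tau> (ball b s)}" for k
  define R where "R k = inverse (real (Suc k))" for k
  have R: "R k > 0" for k by (simp add: R_def)
  define \<epsilon> where "\<epsilon> = (1 - \<theta>) * s"
  have \<epsilon>: "0 < \<epsilon>" using \<theta> assms(5) by (simp add: \<epsilon>_def)
  have avoid: "\<epsilon> * r < norm (y - x - r *\<^sub>R b)"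
    if "x \<in> E k" "y \<in> E k" "0 < r" "r \<le> R k" for x y r k
    unfolding \<epsilon>_def
    by (rule osc_class_avoids_cone[where u = u and \<delta> = \<delta> and \<tau> = \<tau> and R = "R k"])
       (use that \<theta> assms in \<open>auto simp: E_def R_def\<close>)
  have cover: "E_set \<Omega> u \<delta> \<tau> B \<subseteq> (\<Union>k. E k)"
  proof
    fix x assume "x \<in> E_set \<Omega> u \<delta> \<tau> B"
    then obtain r0 where r0: "r0 > 0"
      "\<And>r. 0 < r \<Longrightarrow> r \<le> r0 \<Longrightarrow> blowup u x r \<in> osc_class \<delta> \<tau> (ball b s)"
      using assms(6) by (auto simp: E_set_def)
    obtain k where "inverse (real (Suc k)) < r0" using reals_Archimedean[OF r0(1)] by auto
    then have "x \<in> E k" using r0 by (auto simp: E_def)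
    then show "x \<in> (\<Union>k. E k)" by blast
  qed
  obtain D :: "(real ^ 'n) set" where D: "countable D" "\<And>X. open X \<Longrightarrow> X \<noteq> {} \<Longrightarrow> \<exists>d\<in>D. d \<in> X"
    using countable_dense_setE by blast
  \<comment> \<open>The radius makes distances within a piece at most \<open>R k * norm b\<close>,
    so only scales up to \<open>R k\<close> occur in the cone argument.\<close>
  define piece where "piece = (\<lambda>(k, q). E k \<inter> ball q (R k * norm b / 2))"
  have graph: "\<exists>S. lipschitz_graph S \<and> piece (k, q) \<subseteq> S" if "b \<noteq> 0" for k q
  proof (rule lipschitz_graph_of_small_scales[OF \<epsilon> that])
    fix x y assume "x \<in> piece (k, q)" "y \<in> piece (k, q)"
    then show "dist x y \<le> R k * norm b"
      using dist_triangle_half_r[of q x "R k * norm b" y] by (simp add: piece_def)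
    fix r assume "0 < r" "r \<le> R k"
    then show "\<epsilon> * r < norm (y - x - r *\<^sub>R b)"
      using avoid \<open>x \<in> _\<close> \<open>y \<in> _\<close> by (auto simp: piece_def)
  qed blast
  show ?thesis
  proof (cases "b = 0")
    case True
    \<comment> \<open>For \<open>b = 0\<close>, avoidance with \<open>y = x\<close> and
      \<open>r = R k\<close> would make \<open>\<epsilon> * R k\<close> negative.\<close>
    have "E k = {}" for k
    proof (rule ccontr)
      assume "E k \<noteq> {}"
      then obtain x where "x \<in> E k" by blast
      from avoid[OF this this R[of k]] True mult_pos_pos[OF \<epsilon> R[of k]] show False by simp
    qed
    then show ?thesis using cover by (intro exI[of _ "{}"]) auto
  next
    case False
    then obtain G where G: "\<And>k q. lipschitz_graph (G (k, q)) \<and> piece (k, q) \<subseteq> G (k, q)"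
      using choice[of "\<lambda>i S. lipschitz_graph S \<and> piece i \<subseteq> S"] graph[OF False] by auto
    have "x \<in> \<Union> (G ` (UNIV \<times> D))" if "x \<in> E k" for x k
    proof -
      \<comment> \<open>Since \<open>D\<close> is dense, the countably many balls centred in
        \<open>D\<close> already cover \<open>E k\<close>.\<close>
      obtain q where "q \<in> D" "q \<in> ball x (R k * norm b / 2)"
        using D(2)[of "ball x (R k * norm b / 2)"] R[of k] False
        by (metis ball_eq_empty half_gt_zero linorder_not_le mult_pos_pos open_ball zero_less_norm_iff)
      then have "x \<in> piece (k, q)" using that by (simp add: piece_def dist_commute)
      then show ?thesis using G \<open>q \<in> D\<close> by blast
    qed
    then have "E_set \<Omega> u \<delta> \<tau> B \<subseteq> \<Union> (G ` (UNIV \<times> D))" using cover by blast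
    moreover have "countable (G ` (UNIV \<times> D))" using D(1) by simp
    ultimately show ?thesis using G by (intro exI[of _ "G ` (UNIV \<times> D)"]) auto
  qed
qed

end
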